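(* Let ${\bf U}$ be a unipotent $\mathbb{Z}^2$-action on $\mathbb{Z}^q$, let $k=\dim\mathrm{Fix}({\bf U})$, and let $\mathbb{Z}^q=\mathbb{Z}^{q-k}\times\mathbb{Z}^k$ be a direct product decomposition in which $${\bf U}(\ell)(x,y)=({\bf U}_1(\ell)(x),\ y+{\bf V}(\ell)(x)),\qquad \ell\in\mathbb{Z}^2,$$ where ${\bf U}_1$ is a unipotent $\mathbb{Z}^2$-action on $\mathbb{Z}^{q-k}$ and ${\bf V}:\mathbb{Z}^2\to\mathrm{Hom}_{\mathbb{Z}}(\mathbb{Z}^{q-k},\mathbb{Z}^k)$ is a 1-cocycle over ${\bf U}_1$. Suppose that ${\bf U}_1(\ell)=I$ for all $\ell\in\mathbb{Z}^2$. Then ${\bf U}$ is liberated affine.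
   Context: Here $q\ge1$. A $\mathbb{Z}^p$-action on $\mathbb{Z}^q$ is a homomorphism ${\bf U}:\mathbb{Z}^p\to\mathrm{Aut}(\mathbb{Z}^q)=GL(q,\mathbb{Z})$; it is unipotent if every ${\bf U}(\ell)$ is unipotent. $\mathrm{Fix}({\bf U})=\{m\in\mathbb{Z}^q : {\bf U}(\ell)m=m \text{ for all } \ell\in\mathbb{Z}^p\}$, and $\dim\mathrm{Fix}({\bf U})$ is its rank. Every unipotent action admits a decomposition of the displayed form (with $\{0\}\times\mathbb{Z}^k=\mathrm{Fix}({\bf U})$). The 1-cocycle condition for ${\bf V}$ over ${\bf U}_1$ is ${\bf V}(\ell+\ell')={\bf V}(\ell)\circ{\bf U}_1(\ell')+{\bf V}(\ell')$ for all $\ell,\ell'$. Let $T^q=\mathbb{R}^q/\mathbb{Z}^q$ and let $\mathrm{Affine}(T^q)$ be the group of affine transformations ${\bf x}\mapsto B{\bf x}+{\bf a}$ of $T^q$, with $B\in GL(q,\mathbb{Z})$ and ${\bf a}\in T^q$. An affine $\mathbb{Z}^p$-action on $T^q$ is a homomorphism $\varphi:\mathbb{Z}^p\to\mathrm{Affine}(T^q)$; $\varphi_*$ denotes the induced $\mathbb{Z}^p$-action on $H_1(T^q,\mathbb{Z})=\mathbb{Z}^q$ (the linear part of $\varphi$). The action $\varphi$ is free if $\varphi(\ell)$ has no fixed point on $T^q$ for every $\ell\in\mathbb{Z}^p-\{0\}$. A $\mathbb{Z}^p$-action ${\bf U}$ on $\mathbb{Z}^q$ is liberated affine if there is a free affine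 $\mathbb{Z}^p$-action $\varphi$ on $T^q$ with $\varphi_*={\bf U}$. *)

theory Defs
  imports
    "HOL-Algebra.Bij"
    "HOL-Algebra.Coset"
    "Jordan_Normal_Form.VS_Connect"
begin

section \<open>Actions on a free abelian group\<close>

text \<open>Vectors and matrices have explicit, possibly zero, dimensions. The decomposition
  of the lattice below may have a trivial first factor, so dimensions are not encoded as types.
  A homomorphism between free abelian groups with standard bases is identified with its matrix.\<close>

abbreviation Zgrp :: "nat \<Rightarrow> int vec monoid" where
  "Zgrp n \<equiv> monoid_vec TYPE(int) n"

definition GL :: "nat \<Rightarrow> int mat monoid" where
  "GL q = units_of (ring_mat TYPE(int) q ())"

text \<open>As for all maps on carriers, only the values on \<open>carrier_vec p\<close> matter.\<close>

definition lattice_action :: "nat \<Rightarrow> nat \<Rightarrow> (int vec \<Rightarrow> int mat) \<Rightarrow> bool" where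
  "lattice_action p q U \<longleftrightarrow> U \<in> hom (Zgrp p) (GL q)"

definition unipotent_mat :: "nat \<Rightarrow> int mat \<Rightarrow> bool" where
  "unipotent_mat q A \<longleftrightarrow>
     A \<in> carrier_mat q q \<and> (\<exists>n. (A - 1\<^sub>m q) ^\<^sub>m n = 0\<^sub>m q q)"

definition unipotent_action :: "nat \<Rightarrow> nat \<Rightarrow> (int vec \<Rightarrow> int mat) \<Rightarrow> bool" where
  "unipotent_action p q U \<longleftrightarrow>
     lattice_action p q U \<and> (\<forall>l\<in>carrier_vec p. unipotent_mat q (U l))"

definition Fix :: "nat \<Rightarrow> nat \<Rightarrow> (int vec \<Rightarrow> int mat) \<Rightarrow> int vec set" where
  "Fix p q U = {m \<in> carrier_vec q. \<forall>l\<in>carrier_vec p. U l *\<^sub>v m = m}"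

text \<open>The rank of a subgroup \<open>M\<close> of the lattice of dimension \<open>q\<close> is the largest size of a subset of
  \<open>M\<close> that is linearly independent over the integers.\<close>

definition lattice_rank :: "nat \<Rightarrow> int vec set \<Rightarrow> nat" where
  "lattice_rank q M =
     Max {card S | S. finite S \<and> S \<subseteq> M \<and>
                      \<not> module.lin_dep class_ring (module_vec TYPE(int) q) S}"

text \<open>\<open>V\<close> is a 1-cocycle over \<open>U1\<close> with values in the homomorphisms from the lattice of dimension
  \<open>n\<close> to that of dimension \<open>k\<close>, i.e. in the \<open>k\<close> by \<open>n\<close> integer matrices.\<close>

definition cocycle_over ::
  "nat \<Rightarrow> nat \<Rightarrow> nat \<Rightarrow> (int vec \<Rightarrow> int mat) \<Rightarrow> (int vec \<Rightarrow> int mat) \<Rightarrow> bool" where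
  "cocycle_over p n k U1 V \<longleftrightarrow>
     V \<in> carrier_vec p \<rightarrow> carrier_mat k n \<and>
     (\<forall>l\<in>carrier_vec p. \<forall>l'\<in>carrier_vec p. V (l + l') = V l * U1 l' + V l')"

section \<open>Affine actions on the torus\<close>

text \<open>Points of the torus are cosets of the integer vectors in the real vectors.\<close>

definition torus :: "nat \<Rightarrow> real vec set monoid" where
  "torus q = monoid_vec TYPE(real) q Mod (map_vec real_of_int ` carrier_vec q)"

text \<open>For \<open>B\<close> in \<open>GL q\<close> the image of a coset under \<open>B\<close> is again a coset, namely the image of the
  point under the induced automorphism of the torus; the torus translation by \<open>a\<close> is then applied.\<close>

definition affine_map :: "nat \<Rightarrow> int mat \<Rightarrow> real vec set \<Rightarrow> real vec set \<Rightarrow> real vec set" where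
  "affine_map q B a =
     (\<lambda>x\<in>carrier (torus q). ((\<lambda>v. map_mat real_of_int B *\<^sub>v v) ` x) \<otimes>\<^bsub>torus q\<^esub> a)"

definition Affine :: "nat \<Rightarrow> (real vec set \<Rightarrow> real vec set) monoid" where
  "Affine q = BijGroup (carrier (torus q))
     \<lparr>carrier := {affine_map q B a | B a. B \<in> carrier (GL q) \<and> a \<in> carrier (torus q)}\<rparr>"

text \<open>The linear part of an affine transformation is uniquely determined by it, and is its action on
  the first homology group of the torus.\<close>

definition linear_part :: "nat \<Rightarrow> (real vec set \<Rightarrow> real vec set) \<Rightarrow> int mat" where
  "linear_part q f =
     (THE B. B \<in> carrier (GL q) \<and> (\<exists>a\<in>carrier (torus q). f = affine_map q B a))"

definition affine_action ::
  "nat \<Rightarrow> nat \<Rightarrow> (int vec \<Rightarrow> real vec set \<Rightarrow> real vec set) \<Rightarrow> bool" where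
  "affine_action p q \<phi> \<longleftrightarrow> \<phi> \<in> hom (Zgrp p) (Affine q)"

definition free_action ::
  "nat \<Rightarrow> nat \<Rightarrow> (int vec \<Rightarrow> real vec set \<Rightarrow> real vec set) \<Rightarrow> bool" where
  "free_action p q \<phi> \<longleftrightarrow>
     (\<forall>l\<in>carrier_vec p - {0\<^sub>v p}. \<forall>x\<in>carrier (torus q). \<phi> l x \<noteq> x)"

definition liberated_affine :: "nat \<Rightarrow> nat \<Rightarrow> (int vec \<Rightarrow> int mat) \<Rightarrow> bool" where
  "liberated_affine p q U \<longleftrightarrow>
     (\<exists>\<phi>. affine_action p q \<phi> \<and> free_action p q \<phi> \<and>
          (\<forall>l\<in>carrier_vec p. linear_part q (\<phi> l) = U l))"

end

theory Submission
  imports Defs "Jordan_Normal_Form.Matrix_Kernel" "HOL-Analysis.Continuum_Not_Denumerable"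
begin

text \<open>Put \<open>N(l) = U(l) - 1\<close>. Since \<open>U1\<close> is trivial, all products \<open>N(l) N(l')\<close> vanish, so \<open>N\<close> is additive.
  For translations \<open>u, v\<close> with \<open>N(e1) v = N(e2) u\<close> and \<open>w(l) = l1 u + l2 v\<close>, the affine maps
  \<open>x \<mapsto> U(l) x + w(l) + N(l) w(l) / 2\<close> (the exponentials of commuting affine vector fields) form an
  action. A linear functional \<open>c\<close> that vanishes on the image of \<open>N(l)\<close> shows that the map of \<open>l\<close> has
  no fixed point on the torus, as soon as \<open>c w(l)\<close> differs from the values of \<open>c\<close> at integer points.
  Countably many conditions of this kind are met by a generic pair \<open>(u, v)\<close>, provided that for every
  \<open>l \<noteq> 0\<close> some pair has \<open>w(l)\<close> outside the image of \<open>N(l)\<close>. If that failed, then first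
  the pairs \<open>(l1 y, l2 y) / (l1\<^sup>2 + l2\<^sup>2)\<close> with \<open>y\<close> in the image of \<open>N(e1)\<close> or \<open>N(e2)\<close> would put
  both images inside that of \<open>N(l)\<close>; hence every vector would be some \<open>w(l)\<close>, so \<open>N(l)\<close> would
  be onto, which contradicts \<open>N(l)\<^sup>2 = 0\<close>.\<close>

section \<open>Generic translations\<close>

text \<open>Each nonzero polynomial has finitely many roots, so the roots of all members of
  \<open>P\<close> form a countable set, which cannot exhaust the uncountable real line.\<close>

lemma ex_common_nonroot:
  fixes P :: "real poly set"
  assumes "countable P" and "0 \<notin> P"
  shows "\<exists>t. \<forall>p\<in>P. poly p t \<noteq> 0"
proof -
  have "countable (\<Union>p\<in>P. {t. poly p t = 0})"
    using assms by (intro countable_UN) (auto intro: countable_finite poly_roots_finite)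
  then have "(\<Union>p\<in>P. {t. poly p t = 0}) \<noteq> UNIV"
    using uncountable_UNIV_real by metis
  then show ?thesis by blast
qed

text \<open>Lets a functional be evaluated on a vector of the kernel through its values at the
  members of a basis.\<close>

lemma (in kernel) scalar_prod_lincomb:
  assumes "X \<subseteq> mat_kernel A" and c: "c \<in> carrier_vec nc"
  shows "c \<bullet> lincomb f X = (\<Sum>x\<in>X. f x * (c \<bullet> x))"
proof -
  have X: "X \<subseteq> carrier_vec nc" using assms mat_kernel_carrier[OF A] by auto
  have d: "dim_vec (lincomb f X) = nc"
    using lincomb_same[OF assms(1)] NC.lincomb_dim[of X f]
    by (metis NC.lincomb_closed X carrier_vecD)
  have "c \<bullet> lincomb f X = (\<Sum>i<nc. \<Sum>x\<in>X. f x * (c $ i * x $ i))"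
    unfolding scalar_prod_def d atLeast0LessThan
    by (intro sum.cong refl) (simp add: lincomb_index[OF _ assms(1)] sum_distrib_left mult.left_commute)
  also have "\<dots> = (\<Sum>x\<in>X. f x * (c \<bullet> x))"
    unfolding scalar_prod_def using X
    by (subst sum.swap) (auto intro!: sum.cong simp: sum_distrib_left atLeast0LessThan)
  finally show ?thesis .
qed

text \<open>The point is taken on the curve \<open>\<Sum>i. t^(i+1) b\<^sub>i\<close> through a basis \<open>b\<^sub>i\<close> of the kernel.\<close>

lemma ex_generic_kernel_vector:
  fixes A :: "real mat"
  assumes A: "A \<in> carrier_mat nr nc" and cnt: "countable F"
    and F: "\<And>c r. (c, r) \<in> F \<Longrightarrow> c \<in> carrier_vec nc \<and> (\<exists>w\<in>mat_kernel A. c \<bullet> w \<noteq> 0)"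
  shows "\<exists>w\<in>mat_kernel A. \<forall>(c, r)\<in>F. c \<bullet> w \<noteq> r"
proof -
  interpret kernel nr nc A by unfold_locales (rule A)
  obtain B where B: "finite B" "basis B" using kernel_basis_exists[OF A] by blast
  then have BW: "B \<subseteq> mat_kernel A" and sp: "span B = mat_kernel A"
    unfolding Ker.basis_def by auto
  obtain e :: "real vec \<Rightarrow> nat" where e: "inj_on e B"
    using finite_imp_inj_to_nat_seg[OF B(1)] by blast
  \<comment> \<open>As a polynomial in \<open>t\<close>, \<open>p (c, r)\<close> is \<open>c\<close>
    evaluated on the curve, minus \<open>r\<close>. The exponents start at 1, so the constant term
    is reserved for \<open>r\<close>; injectivity of \<open>e\<close> keeps the monomials of
    different basis vectors apart.\<close>
  define p where "p = (\<lambda>(c, r). (\<Sum>b\<in>B. monom (c \<bullet> b) (Suc (e b))) - [:r:])"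
  have nz: "p (c, r) \<noteq> 0" if "(c, r) \<in> F" for c r
  proof
    assume 0: "p (c, r) = 0"
    from F[OF that] obtain w where c: "c \<in> carrier_vec nc" and w: "w \<in> mat_kernel A" "c \<bullet> w \<noteq> 0"
      by blast
    have "w \<in> {u. \<exists>f. u = lincomb f B}"
      using w(1) sp Ker.finite_span[OF B(1)] BW by auto
    then obtain f where "w = lincomb f B" by blast
    \<comment> \<open>A functional that is nonzero somewhere on the kernel is nonzero at some basis
      vector \<open>b\<close>, and the coefficient of \<open>p (c, r)\<close> at
      \<open>Suc (e b)\<close> is that value.\<close>
    then have "(\<Sum>b\<in>B. f b * (c \<bullet> b)) \<noteq> 0" using scalar_prod_lincomb[OF BW c] w(2) by simp
    then obtain b where "b \<in> B" "f b * (c \<bullet> b) \<noteq> 0" by (rule sum.not_neutral_contains_not_neutral)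
    then have b: "b \<in> B" "c \<bullet> b \<noteq> 0" by auto
    have "coeff (p (c, r)) (Suc (e b)) = (\<Sum>b'\<in>B. if b' = b then c \<bullet> b' else 0)"
      unfolding p_def using b(1) inj_onD[OF e]
      by (auto simp: coeff_sum intro!: sum.cong)
    then show False using 0 b B(1) by (simp add: sum.delta)
  qed
  then have "0 \<notin> p ` F" by (metis imageE surj_pair)
  with ex_common_nonroot[of "p ` F"] cnt obtain t where t: "\<And>x. x \<in> F \<Longrightarrow> poly (p x) t \<noteq> 0"
    by auto
  define w where "w = lincomb (\<lambda>b. t ^ Suc (e b)) B"
  have "w \<in> mat_kernel A" unfolding w_def using BW by (intro Ker.lincomb_closed) auto
  moreover have "c \<bullet> w \<noteq> r" if "(c, r) \<in> F" for c r
    using t[OF that] F[OF that] scalar_prod_lincomb[OF BW, of c]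
    by (auto simp: p_def w_def poly_sum poly_monom mult.commute)
  ultimately show ?thesis by blast
qed

section \<open>Solvability of linear systems over a field\<close>

text \<open>Induction step: if some \<open>d\<close> separates the last column from the earlier ones, the component along
  that column is projected out of both \<open>y\<close> and the separating functional.\<close>

lemma solvable_or_separated:
  fixes v :: "nat \<Rightarrow> 'a :: field vec"
  assumes "\<And>j. j < m \<Longrightarrow> v j \<in> carrier_vec n" and "y \<in> carrier_vec n"
  shows "(\<exists>x. \<forall>i<n. y $ i = (\<Sum>j<m. v j $ i * x j)) \<or>
    (\<exists>c\<in>carrier_vec n. (\<forall>j<m. c \<bullet> v j = 0) \<and> c \<bullet> y \<noteq> 0)"
  using assms
proof (induction m arbitrary: y)
  case 0
  show ?case
  proof (cases "\<forall>i<n. y $ i = 0")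
    case False
    then obtain i where "i < n" "y $ i \<noteq> 0" by blast
    then show ?thesis using 0 by (intro disjI2 bexI[of _ "unit_vec n i"]) auto
  qed simp
next
  case (Suc m)
  note y = Suc.prems(2)
  have v: "v m \<in> carrier_vec n" "\<And>j. j < m \<Longrightarrow> v j \<in> carrier_vec n" using Suc.prems(1) by auto
  have IH: "(\<exists>x. \<forall>i<n. u $ i = (\<Sum>j<m. v j $ i * x j)) \<or>
    (\<exists>c\<in>carrier_vec n. (\<forall>j<m. c \<bullet> v j = 0) \<and> c \<bullet> u \<noteq> 0)" if "u \<in> carrier_vec n" for u
    by (rule Suc.IH) (use v(2) that in auto)
  from IH[OF v(1)] show ?case
  proof (elim disjE exE bexE conjE)
    \<comment> \<open>Here the last column is a combination of the earlier ones: it can receive the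
      coefficient 0, and a functional that kills the earlier columns kills it too.\<close>
    fix x assume x: "\<forall>i<n. v m $ i = (\<Sum>j<m. v j $ i * x j)"
    from IH[OF y] show ?thesis
    proof (elim disjE exE bexE conjE)
      fix z assume "\<forall>i<n. y $ i = (\<Sum>j<m. v j $ i * z j)"
      then show ?thesis by (intro disjI1 exI[of _ "\<lambda>j. if j < m then z j else 0"]) simp
    next
      fix c assume c: "c \<in> carrier_vec n" "\<forall>j<m. c \<bullet> v j = 0" "c \<bullet> y \<noteq> 0"
      have "c \<bullet> v m = (\<Sum>i<n. \<Sum>j<m. x j * (c $ i * v j $ i))"
        using v(1) x by (auto simp: scalar_prod_def atLeast0LessThan sum_distrib_left ac_simps
            intro!: sum.cong)
      also have "\<dots> = (\<Sum>j<m. x j * (c \<bullet> v j))"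
        using carrier_vecD[OF v(2)] by (subst sum.swap)
          (auto simp: scalar_prod_def atLeast0LessThan sum_distrib_left intro!: sum.cong)
      also have "\<dots> = 0" using c(2) by simp
      finally show ?thesis using c by (intro disjI2 bexI[of _ c]) (auto simp: less_Suc_eq)
    qed
  next
    fix d assume d: "d \<in> carrier_vec n" "\<forall>j<m. d \<bullet> v j = 0" "d \<bullet> v m \<noteq> 0"
    \<comment> \<open>With this \<open>s\<close>, the functional \<open>d\<close> vanishes on
      \<open>y - s v m\<close>.\<close>
    define s where "s = (d \<bullet> y) / (d \<bullet> v m)"
    have y': "y - s \<cdot>\<^sub>v v m \<in> carrier_vec n" using y v by auto
    from IH[OF y'] show ?thesis
    proof (elim disjE exE bexE conjE)
      fix z assume z: "\<forall>i<n. (y - s \<cdot>\<^sub>v v m) $ i = (\<Sum>j<m. v j $ i * z j)"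
      have "\<forall>i<n. y $ i = (\<Sum>j<Suc m. v j $ i * (if j < m then z j else s))"
        using z y v(1) by (auto simp: algebra_simps)
      then show ?thesis by (intro disjI1 exI)
    next
      fix c assume c: "c \<in> carrier_vec n" "\<forall>j<m. c \<bullet> v j = 0" "c \<bullet> (y - s \<cdot>\<^sub>v v m) \<noteq> 0"
      \<comment> \<open>Subtracting this multiple of \<open>d\<close> makes the functional vanish on
        \<open>v m\<close>. It still kills the earlier columns, since \<open>d\<close> does, and its
        value at \<open>y\<close> is that of \<open>c\<close> at \<open>y - s v m\<close>.\<close>
      define c' where "c' = c - ((c \<bullet> v m) / (d \<bullet> v m)) \<cdot>\<^sub>v d"
      have c': "c' \<in> carrier_vec n" using c d by (auto simp: c'_def)
      have *: "c' \<bullet> u = c \<bullet> u - (c \<bullet> v m) / (d \<bullet> v m) * (d \<bullet> u)" if "u \<in> carrier_vec n" for u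
        unfolding c'_def using that c(1) d(1) by (subst minus_scalar_prod_distrib[of _ n]) auto
      have "c \<bullet> (y - s \<cdot>\<^sub>v v m) = c \<bullet> y - s * (c \<bullet> v m)"
        using y v(1) c(1) by (subst scalar_prod_minus_distrib[of _ n]) auto
      then have "c' \<bullet> y \<noteq> 0" using c(3) *[OF y] by (simp add: s_def mult.commute)
      moreover have "\<forall>j<Suc m. c' \<bullet> v j = 0"
        using * v c(2) d(2,3) by (auto simp: less_Suc_eq)
      ultimately show ?thesis using c' by blast
    qed
  qed
qed

text \<open>Apply \<open>solvable_or_separated\<close> to the columns of \<open>A\<close>. A
  functional orthogonal to all columns is killed by the transpose of \<open>A\<close>, hence
  annihilates the whole image, and \<open>sep\<close> excludes that it is nonzero at
  \<open>y\<close>.\<close>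

lemma Fredholm_alternative:
  fixes A :: "'a :: field mat"
  assumes A: "A \<in> carrier_mat n m" and y: "y \<in> carrier_vec n"
    and sep: "\<And>c. c \<in> carrier_vec n \<Longrightarrow> (\<And>x. x \<in> carrier_vec m \<Longrightarrow> c \<bullet> (A *\<^sub>v x) = 0) \<Longrightarrow> c \<bullet> y = 0"
  shows "\<exists>x\<in>carrier_vec m. A *\<^sub>v x = y"
proof -
  have colA: "\<And>j. j < m \<Longrightarrow> col A j \<in> carrier_vec n" using A by auto
  have eq: "(A *\<^sub>v vec m x) $ i = (\<Sum>j<m. col A j $ i * x j)" if "i < n" for x i
    using that A by (auto simp: scalar_prod_def atLeast0LessThan intro!: sum.cong)
  have "(\<exists>x. \<forall>i<n. y $ i = (\<Sum>j<m. col A j $ i * x j)) \<or>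
    (\<exists>c\<in>carrier_vec n. (\<forall>j<m. c \<bullet> col A j = 0) \<and> c \<bullet> y \<noteq> 0)"
    by (rule solvable_or_separated) (use colA y in auto)
  then show ?thesis
  proof (elim disjE exE bexE conjE)
    fix x assume "\<forall>i<n. y $ i = (\<Sum>j<m. col A j $ i * x j)"
    then have "A *\<^sub>v vec m x = y" using eq A y by (intro eq_vecI) auto
    then show ?thesis by auto
  next
    fix c assume c: "c \<in> carrier_vec n" "\<forall>j<m. c \<bullet> col A j = 0" "c \<bullet> y \<noteq> 0"
    have At: "transpose_mat A *\<^sub>v c = 0\<^sub>v m"
      using c A by (intro eq_vecI) (auto simp: comm_scalar_prod[of _ n])
    have "c \<bullet> (A *\<^sub>v x) = 0" if "x \<in> carrier_vec m" for x
      using transpose_vec_mult_scalar[OF A that c(1)] At that by simp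
    with sep[OF c(1)] c(3) show ?thesis by blast
  qed
qed

section \<open>Separating functionals for two matrices with vanishing products\<close>

lemma mult_mat_vec_lincomb2:
  fixes A :: "'a :: field mat"
  assumes "A \<in> carrier_mat n m" "x \<in> carrier_vec m" "y \<in> carrier_vec m"
  shows "A *\<^sub>v (a \<cdot>\<^sub>v x + b \<cdot>\<^sub>v y) = a \<cdot>\<^sub>v (A *\<^sub>v x) + b \<cdot>\<^sub>v (A *\<^sub>v y)"
  using assms by (simp add: mult_add_distrib_mat_vec[of _ n m] mult_mat_vec[of _ n m])

lemma lincomb2_mat_mult_vec:
  fixes A B :: "'a :: field mat"
  assumes "A \<in> carrier_mat n m" "B \<in> carrier_mat n m" "x \<in> carrier_vec m"
  shows "(a \<cdot>\<^sub>m A + b \<cdot>\<^sub>m B) *\<^sub>v x = a \<cdot>\<^sub>v (A *\<^sub>v x) + b \<cdot>\<^sub>v (B *\<^sub>v x)"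
  using assms by (intro eq_vecI) (auto simp: add_scalar_prod_distrib[of _ m])

lemma ex_separating_functional:
  fixes N1 N2 :: "real mat"
  defines "M \<equiv> \<lambda>s t. s \<cdot>\<^sub>m N1 + t \<cdot>\<^sub>m N2"
  assumes N: "N1 \<in> carrier_mat q q" "N2 \<in> carrier_mat q q" and q: "q \<noteq> 0"
    and sq: "\<And>A B x. A \<in> {N1, N2} \<Longrightarrow> B \<in> {N1, N2} \<Longrightarrow> x \<in> carrier_vec q \<Longrightarrow> A *\<^sub>v (B *\<^sub>v x) = 0\<^sub>v q"
    and st: "s \<noteq> 0 \<or> t \<noteq> 0"
  shows "\<exists>c\<in>carrier_vec q. (\<forall>x\<in>carrier_vec q. c \<bullet> (M s t *\<^sub>v x) = 0) \<and>
    (\<exists>u\<in>carrier_vec q. \<exists>v\<in>carrier_vec q. N1 *\<^sub>v v = N2 *\<^sub>v u \<and> c \<bullet> (s \<cdot>\<^sub>v u + t \<cdot>\<^sub>v v) \<noteq> 0)"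
proof (rule ccontr)
  assume neg: "\<not> ?thesis"
  have M: "M s t \<in> carrier_mat q q" using N by (auto simp: M_def)
  have Mv: "M s t *\<^sub>v x = s \<cdot>\<^sub>v (N1 *\<^sub>v x) + t \<cdot>\<^sub>v (N2 *\<^sub>v x)" if "x \<in> carrier_vec q" for x
    unfolding M_def using N that by (rule lincomb2_mat_mult_vec)
  have Nc: "\<And>x. N1 *\<^sub>v x \<in> carrier_vec q" "\<And>x. N2 *\<^sub>v x \<in> carrier_vec q"
    using N by (auto intro!: carrier_vecI)
  define d where "d = s\<^sup>2 + t\<^sup>2"
  have d: "d \<noteq> 0" using st by (simp add: d_def sum_power2_eq_zero_iff)
  have std: "s * s / d + t * t / d = 1"
    using d by (simp add: d_def power2_eq_square flip: add_divide_distrib)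
  have zero: "a \<cdot>\<^sub>v 0\<^sub>v q = (0\<^sub>v q :: real vec)" for a by (intro eq_vecI) auto
  \<comment> \<open>By the negated claim, every functional that annihilates the image of
    \<open>M s t\<close> vanishes at \<open>s u + t v\<close>; so this vector lies in the
    image.\<close>
  have key: "\<exists>x\<in>carrier_vec q. M s t *\<^sub>v x = s \<cdot>\<^sub>v u + t \<cdot>\<^sub>v v"
    if "u \<in> carrier_vec q" "v \<in> carrier_vec q" "N1 *\<^sub>v v = N2 *\<^sub>v u" for u v
    by (rule Fredholm_alternative[OF M]) (use that neg in auto)
  have im: "\<exists>x\<in>carrier_vec q. M s t *\<^sub>v x = A *\<^sub>v z"
    if A: "A \<in> {N1, N2}" and z: "z \<in> carrier_vec q" for A z
  proof -
    have y: "A *\<^sub>v z \<in> carrier_vec q" using A Nc by auto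
    \<comment> \<open>The pair \<open>u = (s/d) A z\<close>, \<open>v = (t/d) A z\<close> is
      admissible because both sides are 0 by \<open>sq\<close>, and \<open>s u + t v = A z\<close>
      by the choice of \<open>d\<close>.\<close>
    have "N1 *\<^sub>v ((t / d) \<cdot>\<^sub>v (A *\<^sub>v z)) = N2 *\<^sub>v ((s / d) \<cdot>\<^sub>v (A *\<^sub>v z))"
      using sq[OF _ A z] N y by (simp add: mult_mat_vec[of _ q q] zero)
    from key[OF _ _ this] y obtain x where "x \<in> carrier_vec q"
      "M s t *\<^sub>v x = s \<cdot>\<^sub>v ((s / d) \<cdot>\<^sub>v (A *\<^sub>v z)) + t \<cdot>\<^sub>v ((t / d) \<cdot>\<^sub>v (A *\<^sub>v z))" by auto
    moreover have "s \<cdot>\<^sub>v ((s / d) \<cdot>\<^sub>v y) + t \<cdot>\<^sub>v ((t / d) \<cdot>\<^sub>v y) = y" for y :: "real vec"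
    proof (rule eq_vecI)
      fix i assume "i < dim_vec y"
      then have "(s \<cdot>\<^sub>v ((s / d) \<cdot>\<^sub>v y) + t \<cdot>\<^sub>v ((t / d) \<cdot>\<^sub>v y)) $ i = (s * s / d + t * t / d) * y $ i"
        by (simp add: algebra_simps)
      then show "(s \<cdot>\<^sub>v ((s / d) \<cdot>\<^sub>v y) + t \<cdot>\<^sub>v ((t / d) \<cdot>\<^sub>v y)) $ i = y $ i"
        by (simp only: std mult_1)
    qed simp
    ultimately show ?thesis by auto
  qed
  have onto: "\<exists>x\<in>carrier_vec q. M s t *\<^sub>v x = z" if z: "z \<in> carrier_vec q" for z
  proof -
    from im[of N1, OF _ z] im[of N2, OF _ z] obtain x1 x2
      where x: "x1 \<in> carrier_vec q" "x2 \<in> carrier_vec q" "M s t *\<^sub>v x1 = N1 *\<^sub>v z" "M s t *\<^sub>v x2 = N2 *\<^sub>v z"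
      by auto
    \<comment> \<open>Chosen so that \<open>M s t w = (t N1 z - s N2 z) / d\<close>. This is the
      defect \<open>N1 v - N2 u\<close> of the pair \<open>u = (s/d) z\<close>,
      \<open>v = (t/d) z\<close>.\<close>
    define w where "w = (t / d) \<cdot>\<^sub>v x1 + (- s / d) \<cdot>\<^sub>v x2"
    have w: "w \<in> carrier_vec q" using x by (simp add: w_def)
    have "M s t *\<^sub>v w = (t / d) \<cdot>\<^sub>v (N1 *\<^sub>v z) + (- s / d) \<cdot>\<^sub>v (N2 *\<^sub>v z)"
      unfolding w_def using x by (simp only: mult_mat_vec_lincomb2[OF M])
    then have eq: "s \<cdot>\<^sub>v (N1 *\<^sub>v w) + t \<cdot>\<^sub>v (N2 *\<^sub>v w) = (t / d) \<cdot>\<^sub>v (N1 *\<^sub>v z) + (- s / d) \<cdot>\<^sub>v (N2 *\<^sub>v z)"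
      using Mv[OF w] by simp
    \<comment> \<open>Adding \<open>t w\<close> to \<open>u\<close> and \<open>-s w\<close> to
      \<open>v\<close> leaves \<open>s u + t v = z\<close> unchanged, while
      \<open>N1 v - N2 u\<close> drops by \<open>M s t w\<close> and thus becomes 0.\<close>
    define u v where "u = (s / d) \<cdot>\<^sub>v z + t \<cdot>\<^sub>v w" and "v = (t / d) \<cdot>\<^sub>v z + (- s) \<cdot>\<^sub>v w"
    have uv: "u \<in> carrier_vec q" "v \<in> carrier_vec q" using z w by (auto simp: u_def v_def)
    have "N1 *\<^sub>v v = N2 *\<^sub>v u"
    proof (rule eq_vecI)
      fix i assume "i < dim_vec (N2 *\<^sub>v u)"
      then have i: "i < q" using N by simp
      have "N1 *\<^sub>v v = (t / d) \<cdot>\<^sub>v (N1 *\<^sub>v z) + (- s) \<cdot>\<^sub>v (N1 *\<^sub>v w)"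
        "N2 *\<^sub>v u = (s / d) \<cdot>\<^sub>v (N2 *\<^sub>v z) + t \<cdot>\<^sub>v (N2 *\<^sub>v w)"
        unfolding u_def v_def using N z w by (simp_all only: mult_mat_vec_lincomb2)
      moreover have "s * (N1 *\<^sub>v w) $ i + t * (N2 *\<^sub>v w) $ i = t / d * (N1 *\<^sub>v z) $ i - s / d * (N2 *\<^sub>v z) $ i"
        using arg_cong[OF eq, of "\<lambda>v. v $ i"] i N by (simp del: index_mult_mat_vec)
      ultimately show "(N1 *\<^sub>v v) $ i = (N2 *\<^sub>v u) $ i"
        using i N by (simp del: index_mult_mat_vec)
    qed (use N in simp)
    from key[OF uv this] obtain x where x: "x \<in> carrier_vec q" "M s t *\<^sub>v x = s \<cdot>\<^sub>v u + t \<cdot>\<^sub>v v" by auto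
    have "s \<cdot>\<^sub>v u + t \<cdot>\<^sub>v v = z"
    proof (rule eq_vecI)
      fix i assume "i < dim_vec z"
      then have "i < q" using z by simp
      then have "(s \<cdot>\<^sub>v u + t \<cdot>\<^sub>v v) $ i = (s * s / d + t * t / d) * z $ i"
        using z w by (simp add: u_def v_def algebra_simps)
      then show "(s \<cdot>\<^sub>v u + t \<cdot>\<^sub>v v) $ i = z $ i" by (simp only: std mult_1)
    qed (use uv z in simp)
    with x show ?thesis by auto
  qed
  have sq0: "M s t *\<^sub>v (M s t *\<^sub>v x) = 0\<^sub>v q" if x: "x \<in> carrier_vec q" for x
  proof -
    have "A *\<^sub>v (s \<cdot>\<^sub>v (N1 *\<^sub>v x) + t \<cdot>\<^sub>v (N2 *\<^sub>v x)) = 0\<^sub>v q" if A: "A \<in> {N1, N2}" for A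
    proof -
      have "A \<in> carrier_mat q q" using A N by auto
      from mult_mat_vec_lincomb2[OF this Nc, of s x t x] sq[OF A _ x] show ?thesis
        by (simp add: zero)
    qed
    moreover have "s \<cdot>\<^sub>v (N1 *\<^sub>v x) + t \<cdot>\<^sub>v (N2 *\<^sub>v x) \<in> carrier_vec q" using Nc by auto
    ultimately show ?thesis by (simp add: Mv x zero)
  qed
  \<comment> \<open>Surjectivity used twice writes \<open>z\<close> as \<open>M s t\<close> applied
    twice to some vector, which is 0 by \<open>sq0\<close>.\<close>
  have "z = 0\<^sub>v q" if "z \<in> carrier_vec q" for z :: "real vec"
  proof -
    from onto[OF that] obtain x where x: "x \<in> carrier_vec q" "M s t *\<^sub>v x = z" by blast
    from onto[OF x(1)] obtain w where "w \<in> carrier_vec q" "M s t *\<^sub>v w = x" by blast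
    with x sq0 show ?thesis by blast
  qed
  from this[of "unit_vec q 0"] have "unit_vec q 0 $ 0 = (0\<^sub>v q $ 0 :: real)" by simp
  then show False using q by simp
qed

text \<open>The condition \<open>N1 v = N2 u\<close> says that the affine maps \<open>(1 + N1) x + u\<close> and \<open>(1 + N2) x + v\<close>
  commute.\<close>

lemma ex_generic_translations:
  fixes N1 N2 :: "real mat"
  assumes N: "N1 \<in> carrier_mat q q" "N2 \<in> carrier_mat q q" and q: "q \<noteq> 0"
    and sq: "\<And>A B x. A \<in> {N1, N2} \<Longrightarrow> B \<in> {N1, N2} \<Longrightarrow> x \<in> carrier_vec q \<Longrightarrow> A *\<^sub>v (B *\<^sub>v x) = 0\<^sub>v q"
  shows "\<exists>u\<in>carrier_vec q. \<exists>v\<in>carrier_vec q. N1 *\<^sub>v v = N2 *\<^sub>v u \<and>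
    (\<forall>(s::int) t::int. s \<noteq> 0 \<or> t \<noteq> 0 \<longrightarrow> (\<exists>c\<in>carrier_vec q.
      (\<forall>x\<in>carrier_vec q. c \<bullet> ((of_int s \<cdot>\<^sub>m N1 + of_int t \<cdot>\<^sub>m N2) *\<^sub>v x) = 0) \<and>
      (\<forall>m\<in>carrier_vec q. c \<bullet> (of_int s \<cdot>\<^sub>v u + of_int t \<cdot>\<^sub>v v) \<noteq> c \<bullet> map_vec real_of_int m)))"
proof -
  \<comment> \<open>The kernel of the block row \<open>(-N2 | N1)\<close> is the space of admissible
    pairs, each stored as \<open>u @\<^sub>v v\<close>; the lower blocks have no rows.\<close>
  define C where "C = four_block_mat (- N2) N1 (0\<^sub>m 0 q) (0\<^sub>m 0 q)"
  have C: "C \<in> carrier_mat q (q + q)" using N by (auto simp: C_def)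
  have Cv: "C *\<^sub>v (u @\<^sub>v v) = - (N2 *\<^sub>v u) + N1 *\<^sub>v v" if "u \<in> carrier_vec q" "v \<in> carrier_vec q" for u v
  proof -
    have "C *\<^sub>v (u @\<^sub>v v) = (- N2 *\<^sub>v u + N1 *\<^sub>v v) @\<^sub>v (0\<^sub>m 0 q *\<^sub>v u + 0\<^sub>m 0 q *\<^sub>v v)"
      unfolding C_def using N that by (intro four_block_mat_mult_vec) auto
    also have "\<dots> = - (N2 *\<^sub>v u) + N1 *\<^sub>v v" using N that by (intro eq_vecI) auto
    finally show ?thesis .
  qed
  have ker: "u @\<^sub>v v \<in> mat_kernel C \<longleftrightarrow> N1 *\<^sub>v v = N2 *\<^sub>v u"
    if uv: "u \<in> carrier_vec q" "v \<in> carrier_vec q" for u v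
  proof -
    have "- y + x = 0\<^sub>v q \<longleftrightarrow> x = y" if "x \<in> carrier_vec q" "y \<in> carrier_vec q" for x y :: "real vec"
      using that by (auto simp: vec_eq_iff)
    from this[of "N1 *\<^sub>v v" "N2 *\<^sub>v u"] have "- (N2 *\<^sub>v u) + N1 *\<^sub>v v = 0\<^sub>v q \<longleftrightarrow> N1 *\<^sub>v v = N2 *\<^sub>v u"
      using N by (simp add: carrier_vecI)
    then show ?thesis using uv by (simp add: mat_kernel[OF C] Cv)
  qed
  define S where "S s t c \<longleftrightarrow> c \<in> carrier_vec q \<and>
      (\<forall>x\<in>carrier_vec q. c \<bullet> ((of_int s \<cdot>\<^sub>m N1 + of_int t \<cdot>\<^sub>m N2) *\<^sub>v x) = 0) \<and>
      (\<exists>u\<in>carrier_vec q. \<exists>v\<in>carrier_vec q. N1 *\<^sub>v v = N2 *\<^sub>v u \<and>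
        c \<bullet> (of_int s \<cdot>\<^sub>v u + of_int t \<cdot>\<^sub>v v) \<noteq> 0)" for s t :: int and c
  have "\<exists>c. S s t c" if st: "s \<noteq> 0 \<or> t \<noteq> 0" for s t
  proof -
    have "\<exists>c\<in>carrier_vec q. (\<forall>x\<in>carrier_vec q. c \<bullet> ((of_int s \<cdot>\<^sub>m N1 + of_int t \<cdot>\<^sub>m N2) *\<^sub>v x) = 0) \<and>
      (\<exists>u\<in>carrier_vec q. \<exists>v\<in>carrier_vec q. N1 *\<^sub>v v = N2 *\<^sub>v u \<and>
        c \<bullet> (of_int s \<cdot>\<^sub>v u + of_int t \<cdot>\<^sub>v v) \<noteq> 0)"
      by (rule ex_separating_functional[OF N q]) (use sq st in auto)
    then show ?thesis unfolding S_def by blast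
  qed
  then obtain c where c: "\<And>s t. s \<noteq> 0 \<or> t \<noteq> 0 \<Longrightarrow> S s t (c s t)" by metis
  then have cc: "c s t \<in> carrier_vec q" if "s \<noteq> 0 \<or> t \<noteq> 0" for s t
    using that by (simp add: S_def)
  \<comment> \<open>The functional \<open>(u, v) \<mapsto> c s t \<bullet> (s u + t v)\<close> on
    concatenated pairs.\<close>
  define g where "g s t = (of_int s \<cdot>\<^sub>v c s t) @\<^sub>v (of_int t \<cdot>\<^sub>v c s t)" for s t
  have g: "g s t \<bullet> (u @\<^sub>v v) = c s t \<bullet> (of_int s \<cdot>\<^sub>v u + of_int t \<cdot>\<^sub>v v)"
    if "s \<noteq> 0 \<or> t \<noteq> 0" "u \<in> carrier_vec q" "v \<in> carrier_vec q" for s t u v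
    unfolding g_def using cc[OF that(1)] that(2,3)
    by (subst scalar_prod_append[of _ q _ q]) (auto simp: scalar_prod_add_distrib[of _ q])
  \<comment> \<open>The countable family of equations to be avoided. Letting \<open>m\<close> run
    over the images of all integer lists makes countability immediate; lists of other lengths merely
    add further forbidden values.\<close>
  define F where "F = (\<lambda>((s, t), m). (g s t, c s t \<bullet> map_vec real_of_int m)) `
    ({st. st \<noteq> (0, 0)} \<times> vec_of_list ` (UNIV :: int list set))"
  have "countable F" unfolding F_def by (intro countable_image countable_SIGMA) auto
  moreover have "f \<in> carrier_vec (q + q) \<and> (\<exists>w\<in>mat_kernel C. f \<bullet> w \<noteq> 0)" if "(f, r) \<in> F" for f r
  proof -
    from that obtain s t where st: "s \<noteq> 0 \<or> t \<noteq> 0" and f: "f = g s t" by (auto simp: F_def)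
    from c[OF st] obtain u v where uv: "u \<in> carrier_vec q" "v \<in> carrier_vec q" "N1 *\<^sub>v v = N2 *\<^sub>v u"
      "c s t \<bullet> (of_int s \<cdot>\<^sub>v u + of_int t \<cdot>\<^sub>v v) \<noteq> 0"
      unfolding S_def by blast
    then have "u @\<^sub>v v \<in> mat_kernel C" "g s t \<bullet> (u @\<^sub>v v) \<noteq> 0" using ker g[OF st] by auto
    moreover have "g s t \<in> carrier_vec (q + q)" using cc[OF st] by (simp add: g_def)
    ultimately show ?thesis unfolding f by blast
  qed
  ultimately obtain w where w: "w \<in> mat_kernel C" "\<And>f r. (f, r) \<in> F \<Longrightarrow> f \<bullet> w \<noteq> r"
    using ex_generic_kernel_vector[OF C, of F] by blast
  define u v where "u = vec_first w q" and "v = vec_last w q"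
  have wc: "w \<in> carrier_vec (q + q)" using mat_kernelD(1)[OF C w(1)] .
  have uv: "u \<in> carrier_vec q" "v \<in> carrier_vec q" "u @\<^sub>v v = w"
    unfolding u_def v_def using vec_first_last_append[OF wc] by auto
  have "c s t \<bullet> (of_int s \<cdot>\<^sub>v u + of_int t \<cdot>\<^sub>v v) \<noteq> c s t \<bullet> map_vec real_of_int m"
    if "s \<noteq> 0 \<or> t \<noteq> 0" for s t m
  proof -
    have "m \<in> range vec_of_list" by (metis rangeI vec_list)
    then have "(g s t, c s t \<bullet> map_vec real_of_int m) \<in> F"
      using that unfolding F_def by force
    with w(2) g[OF that uv(1,2)] uv(3) show ?thesis by force
  qed
  moreover have "N1 *\<^sub>v v = N2 *\<^sub>v u" using ker[OF uv(1,2)] w(1) uv(3) by simp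
  ultimately show ?thesis
    using c uv(1,2) unfolding S_def by meson
qed

section \<open>Affine maps of the torus\<close>

text \<open>The quotient map from real vectors to the torus. By \<open>carrier_torus\<close> it is
  onto, which reduces computations on cosets to vectors modulo integer vectors.\<close>

definition torus_point :: "nat \<Rightarrow> real vec \<Rightarrow> real vec set" where
  "torus_point q v = (map_vec real_of_int ` carrier_vec q) #>\<^bsub>monoid_vec TYPE(real) q\<^esub> v"

lemma torus_point_eq:
  "torus_point q v = (\<lambda>m. map_vec real_of_int m + v) ` carrier_vec q"
  by (auto simp: torus_point_def r_coset_def monoid_vec_simps)

lemma integer_lattice_normal:
  "map_vec real_of_int ` carrier_vec q \<lhd> monoid_vec TYPE(real) q"
proof -
  interpret comm_group "monoid_vec TYPE(real) q" by (rule comm_group_vec)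
  have "subgroup (map_vec real_of_int ` carrier_vec q) (monoid_vec TYPE(real) q)"
  proof (rule subgroupI)
    fix a assume "a \<in> map_vec real_of_int ` carrier_vec q"
    then obtain m where m: "m \<in> carrier_vec q" "a = map_vec real_of_int m" by blast
    have "inv\<^bsub>monoid_vec TYPE(real) q\<^esub> a = map_vec real_of_int (- m)"
      using m by (intro inv_equality) (auto simp: monoid_vec_simps)
    then show "inv\<^bsub>monoid_vec TYPE(real) q\<^esub> a \<in> map_vec real_of_int ` carrier_vec q"
      using m by auto
  next
    fix a b assume "a \<in> map_vec real_of_int ` carrier_vec q" "b \<in> map_vec real_of_int ` carrier_vec q"
    then obtain m n where mn: "m \<in> carrier_vec q" "a = map_vec real_of_int m"
      "n \<in> carrier_vec q" "b = map_vec real_of_int n" by blast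
    then have "a + b = map_vec real_of_int (m + n)" by auto
    then show "a \<otimes>\<^bsub>monoid_vec TYPE(real) q\<^esub> b \<in> map_vec real_of_int ` carrier_vec q"
      using mn by (simp add: monoid_vec_simps)
  next
    have "0\<^sub>v q \<in> (carrier_vec q :: int vec set)" by simp
    then show "map_vec real_of_int ` carrier_vec q \<noteq> {}" by blast
  qed (auto simp: monoid_vec_simps)
  then show ?thesis by (rule subgroup_imp_normal)
qed

lemma carrier_torus: "carrier (torus q) = torus_point q ` carrier_vec q"
  by (simp add: torus_def carrier_FactGroup torus_point_def monoid_vec_simps)

lemma torus_point_in_carrier [simp]: "v \<in> carrier_vec q \<Longrightarrow> torus_point q v \<in> carrier (torus q)"
  by (simp add: carrier_torus)

lemma torus_point_add:
  assumes "v \<in> carrier_vec q" "w \<in> carrier_vec q"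
  shows "torus_point q v \<otimes>\<^bsub>torus q\<^esub> torus_point q w = torus_point q (v + w)"
  using normal.rcos_sum[OF integer_lattice_normal, of v q w] assms
  by (simp add: torus_def torus_point_def monoid_vec_simps)

lemma torus_point_eqD:
  assumes "torus_point q v = torus_point q w" and v: "v \<in> carrier_vec q"
  shows "\<exists>m\<in>carrier_vec q. v = map_vec real_of_int m + w"
proof -
  have "v = map_vec real_of_int (0\<^sub>v q) + v" using v by auto
  then have "v \<in> torus_point q v" by (auto simp: torus_point_eq intro!: image_eqI[of _ _ "0\<^sub>v q"])
  then show ?thesis unfolding assms(1) by (auto simp: torus_point_eq)
qed

section \<open>Affine maps and their linear parts\<close>

lemma GL_carrierD:
  assumes "B \<in> carrier (GL q)"
  shows "B \<in> carrier_mat q q" "\<exists>B'\<in>carrier_mat q q. B * B' = 1\<^sub>m q"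
  using assms by (auto simp: GL_def units_of_def Units_def ring_mat_def)

lemma GL_image_torus_point:
  assumes B: "B \<in> carrier (GL q)" and v: "v \<in> carrier_vec q"
  shows "(\<lambda>v. map_mat real_of_int B *\<^sub>v v) ` torus_point q v = torus_point q (map_mat real_of_int B *\<^sub>v v)"
proof -
  note Bc = GL_carrierD(1)[OF B]
  obtain B' where B': "B' \<in> carrier_mat q q" "B * B' = 1\<^sub>m q" using GL_carrierD(2)[OF B] by blast
  have eq: "map_mat real_of_int B *\<^sub>v (map_vec real_of_int m + v) =
      map_vec real_of_int (B *\<^sub>v m) + map_mat real_of_int B *\<^sub>v v" if "m \<in> carrier_vec q" for m
    using that Bc v
    by (simp add: mult_add_distrib_mat_vec[of _ q q] of_int_hom.mult_mat_vec_hom[of _ q q])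
  \<comment> \<open>The integral right inverse \<open>B'\<close> makes \<open>B\<close> map the
    integer lattice onto itself, so the image of a coset is a full coset and not just part of
    one.\<close>
  have "(*\<^sub>v) B ` carrier_vec q = carrier_vec q"
  proof (intro equalityI subsetI)
    fix m :: "int vec" assume m: "m \<in> carrier_vec q"
    have "m = B *\<^sub>v (B' *\<^sub>v m)" using m Bc B' by (metis assoc_mult_mat_vec one_mult_mat_vec)
    moreover have "B' *\<^sub>v m \<in> carrier_vec q" using m B' by auto
    ultimately show "m \<in> (*\<^sub>v) B ` carrier_vec q" by blast
  qed (use Bc in auto)
  then have "torus_point q (map_mat real_of_int B *\<^sub>v v) =
      (\<lambda>m. map_vec real_of_int m + map_mat real_of_int B *\<^sub>v v) ` (*\<^sub>v) B ` carrier_vec q"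
    by (simp add: torus_point_eq)
  also have "\<dots> = (\<lambda>v. map_mat real_of_int B *\<^sub>v v) ` torus_point q v"
    unfolding torus_point_eq image_image by (intro image_cong refl) (simp add: eq)
  finally show ?thesis by simp
qed

lemma affine_map_torus_point:
  assumes "B \<in> carrier (GL q)" "a \<in> carrier_vec q" "v \<in> carrier_vec q"
  shows "affine_map q B (torus_point q a) (torus_point q v) =
    torus_point q (map_mat real_of_int B *\<^sub>v v + a)"
  using assms GL_carrierD(1)[OF assms(1)]
  by (simp add: affine_map_def GL_image_torus_point torus_point_add)

lemma affine_map_extensional: "affine_map q B a \<in> extensional (carrier (torus q))"
  by (simp add: affine_map_def)

text \<open>If \<open>d\<close> were nonzero, \<open>r = 1 / (2 d)\<close> would make 1/2 an
  integer.\<close>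

lemma of_int_mult_Ints_imp_0:
  fixes d :: int
  assumes "\<And>r::real. of_int d * r \<in> \<int>"
  shows "d = 0"
proof (rule ccontr)
  assume "d \<noteq> 0"
  then have "of_int d * (1 / (2 * of_int d)) = (1 / 2 :: real)" by simp
  then have "(1 / 2 :: real) \<in> \<int>" using assms by metis
  then show False by (auto elim!: Ints_cases) 
qed

text \<open>Shows that the definite description is well defined. If two affine maps agree on the
  torus, their lifts differ by integer vectors: at 0 this makes the difference of the translations
  integral, and at \<open>r\<close> times a unit vector it then makes each entry of
  \<open>B - B'\<close> times \<open>r\<close> integral, for every real \<open>r\<close>.\<close>

lemma linear_part_affine_map:
  assumes B: "B \<in> carrier (GL q)" and a: "a \<in> carrier (torus q)"
  shows "linear_part q (affine_map q B a) = B"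
  unfolding linear_part_def
proof (rule the_equality)
  show "B \<in> carrier (GL q) \<and> (\<exists>a'\<in>carrier (torus q). affine_map q B a = affine_map q B a')"
    using B a by blast
next
  fix B' assume "B' \<in> carrier (GL q) \<and> (\<exists>a'\<in>carrier (torus q). affine_map q B a = affine_map q B' a')"
  then obtain a' where B': "B' \<in> carrier (GL q)" and a': "a' \<in> carrier (torus q)"
    and eq: "affine_map q B a = affine_map q B' a'" by blast
  obtain b b' where b: "b \<in> carrier_vec q" "a = torus_point q b"
    and b': "b' \<in> carrier_vec q" "a' = torus_point q b'"
    using a a' by (auto simp: carrier_torus)
  note Bc = GL_carrierD(1)[OF B] and Bc' = GL_carrierD(1)[OF B']
  have int: "\<exists>m\<in>carrier_vec q. map_mat real_of_int B *\<^sub>v v + b = map_vec real_of_int m + (map_mat real_of_int B' *\<^sub>v v + b')"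
    if v: "v \<in> carrier_vec q" for v
  proof (rule torus_point_eqD)
    show "torus_point q (map_mat real_of_int B *\<^sub>v v + b) = torus_point q (map_mat real_of_int B' *\<^sub>v v + b')"
      using eq affine_map_torus_point[OF B b(1) v] affine_map_torus_point[OF B' b'(1) v] b(2) b'(2) by simp
  qed (use Bc b v in auto)
  have "b $ i - b' $ i \<in> \<int>" if i: "i < q" for i
  proof -
    from int[of "0\<^sub>v q"] obtain m where m: "m \<in> carrier_vec q"
      "map_mat real_of_int B *\<^sub>v 0\<^sub>v q + b = map_vec real_of_int m + (map_mat real_of_int B' *\<^sub>v 0\<^sub>v q + b')" by auto
    have "b $ i - b' $ i = of_int (m $ i)"
      using arg_cong[OF m(2), of "\<lambda>x. x $ i"] i m(1) b b' Bc Bc' by simp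
    then show ?thesis by simp
  qed
  note bb = this
  show "B' = B"
  proof (rule eq_matI)
    fix i j assume "i < dim_row B" "j < dim_col B"
    then have ij: "i < q" "j < q" using Bc by auto
    have "of_int (B $$ (i, j) - B' $$ (i, j)) * r \<in> \<int>" for r :: real
    proof -
      define v where "v = r \<cdot>\<^sub>v unit_vec q j"
      have v: "v \<in> carrier_vec q" by (simp add: v_def)
      from int[OF v] obtain m where m: "m \<in> carrier_vec q"
        "map_mat real_of_int B *\<^sub>v v + b = map_vec real_of_int m + (map_mat real_of_int B' *\<^sub>v v + b')" by blast
      have ev: "(map_mat real_of_int C *\<^sub>v v) $ i = of_int (C $$ (i, j)) * r" if "C \<in> carrier_mat q q" for C
        using that ij by (simp add: v_def scalar_prod_right_unit)
      have "of_int (B $$ (i, j)) * r + b $ i = of_int (m $ i) + (of_int (B' $$ (i, j)) * r + b' $ i)"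
        using arg_cong[OF m(2), of "\<lambda>x. x $ i"] ij m(1) b b' Bc Bc' ev[OF Bc] ev[OF Bc']
        by (simp del: index_mult_mat_vec)
      then have "of_int (B $$ (i, j) - B' $$ (i, j)) * r = of_int (m $ i) - (b $ i - b' $ i)"
        by (simp add: algebra_simps)
      then show ?thesis using bb[OF ij(1)] by simp
    qed
    then have "B $$ (i, j) - B' $$ (i, j) = 0" by (rule of_int_mult_Ints_imp_0)
    then show "B' $$ (i, j) = B $$ (i, j)" by simp
  qed (use Bc Bc' in auto)
qed

section \<open>Affine actions from cocycles, and their fixed points\<close>

lemma group_GL: "group (GL q)"
proof -
  interpret ring "ring_mat TYPE(int) q ()" by (rule ring_mat)
  show ?thesis unfolding GL_def by (rule units_group)
qed

lemma lattice_actionD: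
  assumes "lattice_action p q U"
  shows "l \<in> carrier_vec p \<Longrightarrow> U l \<in> carrier (GL q)"
    and "l \<in> carrier_vec p \<Longrightarrow> l' \<in> carrier_vec p \<Longrightarrow> U (l + l') = U l * U l'"
    and "U (0\<^sub>v p) = 1\<^sub>m q"
proof -
  have U: "U \<in> hom (Zgrp p) (GL q)" using assms by (simp add: lattice_action_def)
  show "l \<in> carrier_vec p \<Longrightarrow> U l \<in> carrier (GL q)"
    using hom_in_carrier[OF U] by (simp add: monoid_vec_simps)
  show "l \<in> carrier_vec p \<Longrightarrow> l' \<in> carrier_vec p \<Longrightarrow> U (l + l') = U l * U l'"
    using hom_mult[OF U] by (simp add: monoid_vec_simps GL_def units_of_def ring_mat_def)
  have "group (Zgrp p)" by (rule comm_group.axioms(2)[OF comm_group_vec])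
  from hom_one[OF U this group_GL] show "U (0\<^sub>v p) = 1\<^sub>m q"
    by (simp add: monoid_vec_simps GL_def units_of_def ring_mat_def)
qed

text \<open>The identity \<open>coc\<close> is the composition law for the lifts
  \<open>v \<mapsto> U l v + \<alpha> l\<close>, so it passes to the torus.\<close>

lemma affine_action_of_cocycle:
  assumes U: "lattice_action p q U"
    and \<alpha>: "\<And>l. l \<in> carrier_vec p \<Longrightarrow> \<alpha> l \<in> carrier_vec q"
    and coc: "\<And>l l'. l \<in> carrier_vec p \<Longrightarrow> l' \<in> carrier_vec p \<Longrightarrow>
      \<alpha> (l + l') = map_mat real_of_int (U l) *\<^sub>v \<alpha> l' + \<alpha> l"
  shows "affine_action p q (\<lambda>l. affine_map q (U l) (torus_point q (\<alpha> l)))"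
proof -
  define \<phi> where "\<phi> l = affine_map q (U l) (torus_point q (\<alpha> l))" for l
  let ?T = "carrier (torus q)"
  note UGL = lattice_actionD(1)[OF U] and Um = lattice_actionD(2)[OF U]
  have Uc: "map_mat real_of_int (U l) \<in> carrier_mat q q" if "l \<in> carrier_vec p" for l
    using GL_carrierD(1)[OF UGL[OF that]] by simp
  have ext: "\<phi> l \<in> extensional ?T" for l by (simp add: \<phi>_def affine_map_extensional)
  have \<phi>: "\<phi> l (torus_point q v) = torus_point q (map_mat real_of_int (U l) *\<^sub>v v + \<alpha> l)"
    if "l \<in> carrier_vec p" "v \<in> carrier_vec q" for l v
    unfolding \<phi>_def using that by (simp add: affine_map_torus_point UGL \<alpha>)
  have closed: "\<phi> l x \<in> ?T" if "l \<in> carrier_vec p" "x \<in> ?T" for l x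
    using that \<phi>[OF that(1)] \<alpha>[OF that(1)] Uc[OF that(1)] by (auto simp: carrier_torus)
  have comp: "\<phi> (l + l') x = \<phi> l (\<phi> l' x)"
    if l: "l \<in> carrier_vec p" "l' \<in> carrier_vec p" and x: "x \<in> ?T" for l l' x
  proof -
    from x obtain v where v: "v \<in> carrier_vec q" "x = torus_point q v" by (auto simp: carrier_torus)
    have v': "map_mat real_of_int (U l') *\<^sub>v v \<in> carrier_vec q" using Uc[OF l(2)] v by auto
    have v'': "map_mat real_of_int (U l) *\<^sub>v (map_mat real_of_int (U l') *\<^sub>v v) \<in> carrier_vec q"
      and \<alpha>': "map_mat real_of_int (U l) *\<^sub>v \<alpha> l' \<in> carrier_vec q"
      using Uc[OF l(1)] v' \<alpha>[OF l(2)] by auto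
    have "map_mat real_of_int (U (l + l')) = map_mat real_of_int (U l) * map_mat real_of_int (U l')"
      unfolding Um[OF l] using UGL l by (intro of_int_hom.mat_hom_mult[of _ q q _ q] GL_carrierD(1)) auto
    then have "map_mat real_of_int (U (l + l')) *\<^sub>v v + \<alpha> (l + l') =
        map_mat real_of_int (U l) *\<^sub>v (map_mat real_of_int (U l') *\<^sub>v v + \<alpha> l') + \<alpha> l"
      using assoc_mult_mat_vec[OF Uc[OF l(1)] Uc[OF l(2)] v(1)] coc[OF l]
        mult_add_distrib_mat_vec[OF Uc[OF l(1)] v' \<alpha>[OF l(2)]]
        assoc_add_vec[OF v'' \<alpha>' \<alpha>[OF l(1)]]
      by simp
    then show ?thesis using \<phi> l v v' \<alpha> by simp
  qed
  \<comment> \<open>The cocycle identity at \<open>(0, 0)\<close> forces the translation of 0 to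
    vanish; thus 0 acts as the identity and \<open>- l\<close> inverts \<open>l\<close>.\<close>
  have "\<alpha> (0\<^sub>v p) = \<alpha> (0\<^sub>v p) + \<alpha> (0\<^sub>v p)"
    using coc[of "0\<^sub>v p" "0\<^sub>v p"] \<alpha>[of "0\<^sub>v p"] lattice_actionD(3)[OF U]
    by (simp add: of_int_hom.mat_hom_one)
  then have \<alpha>0: "\<alpha> (0\<^sub>v p) = 0\<^sub>v q"
    using \<alpha>[of "0\<^sub>v p"] by (auto simp: vec_eq_iff)
  have id: "\<phi> (0\<^sub>v p) x = x" if "x \<in> ?T" for x
    using that \<phi>[of "0\<^sub>v p"] by (auto simp: carrier_torus lattice_actionD(3)[OF U] \<alpha>0 of_int_hom.mat_hom_one)
  have bij: "\<phi> l \<in> Bij ?T" if l: "l \<in> carrier_vec p" for l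
  proof -
    have l': "- l \<in> carrier_vec p" using l by simp
    have "l + - l = 0\<^sub>v p" "- l + l = 0\<^sub>v p" using l by auto
    then have "bij_betw (\<phi> l) ?T ?T"
      using comp[OF l l'] comp[OF l' l] id closed[OF l] closed[OF l']
      by (intro bij_betw_byWitness[of _ "\<phi> (- l)"]) auto
    then show ?thesis using ext by (simp add: Bij_def)
  qed
  have "\<phi> \<in> hom (Zgrp p) (Affine q)"
  proof (rule homI)
    fix l assume "l \<in> carrier (Zgrp p)"
    then show "\<phi> l \<in> carrier (Affine q)"
      using UGL[of l] torus_point_in_carrier[OF \<alpha>[of l]] unfolding Affine_def \<phi>_def
      by (simp add: monoid_vec_simps) blast
  next
    fix l l' assume "l \<in> carrier (Zgrp p)" "l' \<in> carrier (Zgrp p)"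
    then have l: "l \<in> carrier_vec p" "l' \<in> carrier_vec p" by (simp_all add: monoid_vec_simps)
    have "\<phi> (l + l') = compose ?T (\<phi> l) (\<phi> l')"
      using ext by (intro extensionalityI[of _ ?T]) (auto simp: compose_def comp l)
    then show "\<phi> (l \<otimes>\<^bsub>Zgrp p\<^esub> l') = \<phi> l \<otimes>\<^bsub>Affine q\<^esub> \<phi> l'"
      using bij l by (simp add: Affine_def BijGroup_def monoid_vec_simps)
  qed
  then show ?thesis by (simp add: affine_action_def \<phi>_def[abs_def])
qed

text \<open>A fixed point lifts to \<open>B v + a = m + v\<close> with \<open>m\<close> integral.
  Applying \<open>c\<close>, which does not distinguish \<open>B v\<close> from \<open>v\<close>,
  leaves \<open>c \<bullet> a = c \<bullet> m\<close>, excluded by \<open>nint\<close>.\<close>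

lemma free_affine_map:
  assumes B: "B \<in> carrier (GL q)" and a: "a \<in> carrier_vec q" and c: "c \<in> carrier_vec q"
    and ann: "\<And>v. v \<in> carrier_vec q \<Longrightarrow> c \<bullet> (map_mat real_of_int B *\<^sub>v v) = c \<bullet> v"
    and nint: "\<And>m. m \<in> carrier_vec q \<Longrightarrow> c \<bullet> a \<noteq> c \<bullet> map_vec real_of_int m"
    and x: "x \<in> carrier (torus q)"
  shows "affine_map q B (torus_point q a) x \<noteq> x"
proof
  assume fp: "affine_map q B (torus_point q a) x = x"
  from x obtain v where v: "v \<in> carrier_vec q" "x = torus_point q v" by (auto simp: carrier_torus)
  have Bv: "map_mat real_of_int B *\<^sub>v v \<in> carrier_vec q" using GL_carrierD(1)[OF B] v by auto
  have "torus_point q (map_mat real_of_int B *\<^sub>v v + a) = torus_point q v"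
    using fp affine_map_torus_point[OF B a v(1)] v(2) by simp
  from torus_point_eqD[OF this] Bv a obtain m where m: "m \<in> carrier_vec q"
    "map_mat real_of_int B *\<^sub>v v + a = map_vec real_of_int m + v" by auto
  have "c \<bullet> v + c \<bullet> a = c \<bullet> map_vec real_of_int m + c \<bullet> v"
    using arg_cong[OF m(2), of "\<lambda>w. c \<bullet> w"] ann[OF v(1)] c Bv a v m(1)
    by (simp add: scalar_prod_add_distrib[of _ q])
  then show False using nint[OF m(1)] by simp
qed

text \<open>Additivity gives homogeneity under integers, by induction upwards and downwards from 0.
  The lemma serves to expand the entries of \<open>U l - 1\<close> in the two generators.\<close>

lemma additive_on_int_vec_2:
  fixes g :: "int vec \<Rightarrow> int"
  assumes add: "\<And>l l'. l \<in> carrier_vec 2 \<Longrightarrow> l' \<in> carrier_vec 2 \<Longrightarrow> g (l + l') = g l + g l'"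
    and l: "l \<in> carrier_vec 2"
  shows "g l = l $ 0 * g (unit_vec 2 0) + l $ 1 * g (unit_vec 2 1)"
proof -
  have "g (0\<^sub>v 2) = g (0\<^sub>v 2) + g (0\<^sub>v 2)" using add[of "0\<^sub>v 2" "0\<^sub>v 2"] by simp
  then have g0: "g (0\<^sub>v 2) = 0" by simp
  have smult: "g (n \<cdot>\<^sub>v v) = n * g v" if v: "v \<in> carrier_vec 2" for n v
  proof (induction n rule: int_induct[where k = 0])
    case base
    have "0 \<cdot>\<^sub>v v = 0\<^sub>v 2" using v by (intro eq_vecI) auto
    then show ?case using g0 by simp
  next
    case (step1 n)
    have "(n + 1) \<cdot>\<^sub>v v = n \<cdot>\<^sub>v v + v" by (intro eq_vecI) (auto simp: algebra_simps)
    then show ?case using step1 add[of "n \<cdot>\<^sub>v v" v] v by (simp add: algebra_simps)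
  next
    case (step2 n)
    have "n \<cdot>\<^sub>v v = (n - 1) \<cdot>\<^sub>v v + v" by (intro eq_vecI) (auto simp: algebra_simps)
    then show ?case using step2 add[of "(n - 1) \<cdot>\<^sub>v v" v] v by (simp add: algebra_simps)
  qed
  have "l = (l $ 0) \<cdot>\<^sub>v unit_vec 2 0 + (l $ 1) \<cdot>\<^sub>v unit_vec 2 1"
    using l by (intro eq_vecI) (auto simp: less_2_cases_iff)
  then have "g l = g ((l $ 0) \<cdot>\<^sub>v unit_vec 2 0) + g ((l $ 1) \<cdot>\<^sub>v unit_vec 2 1)"
    using add by (metis smult_carrier_vec unit_vec_carrier)
  then show ?thesis by (simp add: smult)
qed

section \<open>Square-zero actions\<close>

lemma liberated_affine_of_square_zero:
  assumes U: "lattice_action 2 q U" and q: "q \<noteq> 0"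
    and sq: "\<And>l l'. l \<in> carrier_vec 2 \<Longrightarrow> l' \<in> carrier_vec 2 \<Longrightarrow>
      (U l - 1\<^sub>m q) * (U l' - 1\<^sub>m q) = 0\<^sub>m q q"
  shows "liberated_affine 2 q U"
proof -
  note UGL = lattice_actionD(1)[OF U] and Um = lattice_actionD(2)[OF U]
  note Uc = GL_carrierD(1)[OF UGL]
  define D where "D l = U l - 1\<^sub>m q" for l
  have Dc: "D l \<in> carrier_mat q q" if "l \<in> carrier_vec 2" for l
    by (simp add: D_def minus_carrier_mat)
  have D_add: "D (l + l') = D l + D l'" if l: "l \<in> carrier_vec 2" "l' \<in> carrier_vec 2" for l l'
  proof -
    \<comment> \<open>Expanding the vanishing product \<open>D l * D l'\<close> with
      \<open>U l * U l' = U (l + l')\<close> gives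
      \<open>0 = U (l + l') - U l' - U l + 1\<close>.\<close>
    have "0\<^sub>m q q = (U l - 1\<^sub>m q) * U l' - (U l - 1\<^sub>m q) * 1\<^sub>m q"
      using sq[OF l] Uc[OF l(1)] Uc[OF l(2)] mult_minus_distrib_mat[of "U l - 1\<^sub>m q" q q "U l'" q "1\<^sub>m q"]
      by (simp add: minus_carrier_mat)
    also have "(U l - 1\<^sub>m q) * U l' = U (l + l') - U l'"
      using Um[OF l] Uc[OF l(1)] Uc[OF l(2)] minus_mult_distrib_mat[of "U l" q q "1\<^sub>m q" "U l'" q] by simp
    finally have "0\<^sub>m q q = (U (l + l') - U l') - (U l - 1\<^sub>m q)"
      using Uc[OF l(1)] by simp
    then show ?thesis
      using Uc[OF l(1)] Uc[OF l(2)] Uc[of "l + l'"] l by (auto simp: D_def mat_eq_iff algebra_simps)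
  qed
  define N where "N i = map_mat real_of_int (D (unit_vec 2 i))" for i
  have N: "N i \<in> carrier_mat q q" for i using Dc[of "unit_vec 2 i"] by (simp add: N_def)
  have NN: "N i *\<^sub>v (N j *\<^sub>v x) = 0\<^sub>v q" if x: "x \<in> carrier_vec q" for i j x
  proof -
    have "N i * N j = map_mat real_of_int (D (unit_vec 2 i) * D (unit_vec 2 j))"
      unfolding N_def using Dc by (intro of_int_hom.mat_hom_mult[symmetric, of _ q q _ q]) auto
    also have "D (unit_vec 2 i) * D (unit_vec 2 j) = 0\<^sub>m q q"
      unfolding D_def by (rule sq) auto
    also have "map_mat real_of_int (0\<^sub>m q q) = 0\<^sub>m q q" by (intro eq_matI) auto
    finally have "N i *\<^sub>v (N j *\<^sub>v x) = 0\<^sub>m q q *\<^sub>v x" using assoc_mult_mat_vec[OF N N x, of i j] by simp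
    also have "\<dots> = 0\<^sub>v q" using x by (intro eq_vecI) auto
    finally show ?thesis .
  qed
  define M where "M l = of_int (l $ 0) \<cdot>\<^sub>m N 0 + of_int (l $ 1) \<cdot>\<^sub>m N 1" for l :: "int vec"
  have Mc: "M l \<in> carrier_mat q q" for l using N by (simp add: M_def)
  have Ureal: "map_mat real_of_int (U l) = 1\<^sub>m q + M l" if l: "l \<in> carrier_vec 2" for l
  proof (rule eq_matI)
    fix i j assume "i < dim_row (1\<^sub>m q + M l)" "j < dim_col (1\<^sub>m q + M l)"
    then have ij: "i < q" "j < q" using Mc[of l] by auto
    have Dd: "dim_row (D l) = q" "dim_col (D l) = q" if "l \<in> carrier_vec 2" for l
      using Dc[OF that] by auto
    have "D l $$ (i, j) = l $ 0 * D (unit_vec 2 0) $$ (i, j) + l $ 1 * D (unit_vec 2 1) $$ (i, j)"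
      by (rule additive_on_int_vec_2[OF _ l]) (use ij in \<open>simp add: D_add Dd\<close>)
    moreover have "U l $$ (i, j) = D l $$ (i, j) + 1\<^sub>m q $$ (i, j)"
      using ij Uc[OF l] by (simp add: D_def)
    ultimately show "map_mat real_of_int (U l) $$ (i, j) = (1\<^sub>m q + M l) $$ (i, j)"
      using ij Uc[OF l] Dd by (simp add: M_def N_def)
  qed (use Mc[of l] Uc[OF l] in auto)
  have "\<exists>u\<in>carrier_vec q. \<exists>v\<in>carrier_vec q. N 0 *\<^sub>v v = N 1 *\<^sub>v u \<and>
    (\<forall>(s::int) t::int. s \<noteq> 0 \<or> t \<noteq> 0 \<longrightarrow> (\<exists>c\<in>carrier_vec q.
      (\<forall>x\<in>carrier_vec q. c \<bullet> ((of_int s \<cdot>\<^sub>m N 0 + of_int t \<cdot>\<^sub>m N 1) *\<^sub>v x) = 0) \<and>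
      (\<forall>m\<in>carrier_vec q. c \<bullet> (of_int s \<cdot>\<^sub>v u + of_int t \<cdot>\<^sub>v v) \<noteq> c \<bullet> map_vec real_of_int m)))"
    by (rule ex_generic_translations[OF N N q]) (use NN in auto)
  then obtain u v where uv: "u \<in> carrier_vec q" "v \<in> carrier_vec q" and comm: "N 0 *\<^sub>v v = N 1 *\<^sub>v u"
    and gen: "\<And>(s::int) t::int. s \<noteq> 0 \<or> t \<noteq> 0 \<Longrightarrow> \<exists>c\<in>carrier_vec q.
      (\<forall>x\<in>carrier_vec q. c \<bullet> ((of_int s \<cdot>\<^sub>m N 0 + of_int t \<cdot>\<^sub>m N 1) *\<^sub>v x) = 0) \<and>
      (\<forall>m\<in>carrier_vec q. c \<bullet> (of_int s \<cdot>\<^sub>v u + of_int t \<cdot>\<^sub>v v) \<noteq> c \<bullet> map_vec real_of_int m)"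
    by blast
  define w where "w l = of_int (l $ 0) \<cdot>\<^sub>v u + of_int (l $ 1) \<cdot>\<^sub>v v" for l :: "int vec"
  have wc: "w l \<in> carrier_vec q" for l using uv by (simp add: w_def)
  have w_add: "w (l + l') = w l + w l'" if "l \<in> carrier_vec 2" "l' \<in> carrier_vec 2" for l l'
    using that uv by (intro eq_vecI) (auto simp: w_def algebra_simps)
  have Mv: "M l *\<^sub>v x = of_int (l $ 0) \<cdot>\<^sub>v (N 0 *\<^sub>v x) + of_int (l $ 1) \<cdot>\<^sub>v (N 1 *\<^sub>v x)"
    if "x \<in> carrier_vec q" for l x
    unfolding M_def using N N that by (rule lincomb2_mat_mult_vec)
  have Nc: "N i *\<^sub>v x \<in> carrier_vec q" for i x using N[of i] by (auto intro!: carrier_vecI)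
  have Nw: "N i *\<^sub>v w l = of_int (l $ 0) \<cdot>\<^sub>v (N i *\<^sub>v u) + of_int (l $ 1) \<cdot>\<^sub>v (N i *\<^sub>v v)" for i l
    unfolding w_def using N uv by (rule mult_mat_vec_lincomb2)
  \<comment> \<open>The bilinear expression \<open>M l (w l')\<close> is symmetric: its mixed terms
    are \<open>N 0 v\<close> and \<open>N 1 u\<close>, which agree by \<open>comm\<close>.\<close>
  have Mw: "M l *\<^sub>v w l' = M l' *\<^sub>v w l" for l l'
  proof -
    have "r \<cdot>\<^sub>v (r' \<cdot>\<^sub>v a + t' \<cdot>\<^sub>v b) + t \<cdot>\<^sub>v (r' \<cdot>\<^sub>v b + t' \<cdot>\<^sub>v c) =
        r' \<cdot>\<^sub>v (r \<cdot>\<^sub>v a + t \<cdot>\<^sub>v b) + t' \<cdot>\<^sub>v (r \<cdot>\<^sub>v b + t \<cdot>\<^sub>v c)"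
      if "a \<in> carrier_vec q" "b \<in> carrier_vec q" "c \<in> carrier_vec q" for a b c and r r' t t' :: real
      using that by (intro eq_vecI) (auto simp: algebra_simps)
    from this[OF Nc Nc Nc] show ?thesis unfolding Mv[OF wc] Nw comm .
  qed
  have MMw: "M l *\<^sub>v (M l' *\<^sub>v x) = 0\<^sub>v q" if x: "x \<in> carrier_vec q" for l l' x
  proof -
    have "N i *\<^sub>v (M l' *\<^sub>v x) = 0\<^sub>v q" for i
      unfolding Mv[OF x] mult_mat_vec_lincomb2[OF N Nc Nc] NN[OF x] by (intro eq_vecI) auto
    moreover have "M l' *\<^sub>v x \<in> carrier_vec q" using Mc[of l'] by (auto intro!: carrier_vecI)
    ultimately show ?thesis by (simp add: Mv) (intro eq_vecI, auto)
  qed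
  \<comment> \<open>The factor 1/2 makes the cocycle identity hold: the quadratic term at
    \<open>l + l'\<close> has two equal cross terms, whose half-sum is the \<open>M l (w l')\<close>
    produced by the linear part.\<close>
  define \<alpha> where "\<alpha> l = w l + (1 / 2) \<cdot>\<^sub>v (M l *\<^sub>v w l)" for l
  have Mxc: "M l *\<^sub>v x \<in> carrier_vec q" for l x using Mc[of l] by (auto intro!: carrier_vecI)
  have \<alpha>c: "\<alpha> l \<in> carrier_vec q" for l using wc Mxc by (simp add: \<alpha>_def)
  have Uv: "map_mat real_of_int (U l) *\<^sub>v x = x + M l *\<^sub>v x"
    if "l \<in> carrier_vec 2" "x \<in> carrier_vec q" for l x
    unfolding Ureal[OF that(1)] using that(2) Mc[of l] by (simp add: add_mult_distrib_mat_vec[of _ q q])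
  \<comment> \<open>The correction in \<open>\<alpha> l'\<close> lies in the image of
    \<open>M l'\<close>, which every \<open>M l\<close> kills.\<close>
  have M\<alpha>: "M l *\<^sub>v \<alpha> l' = M l *\<^sub>v w l'" for l l'
  proof -
    have "M l *\<^sub>v \<alpha> l' = M l *\<^sub>v (1 \<cdot>\<^sub>v w l' + (1 / 2) \<cdot>\<^sub>v (M l' *\<^sub>v w l'))" by (simp add: \<alpha>_def)
    also have "\<dots> = M l *\<^sub>v w l' + (1 / 2) \<cdot>\<^sub>v 0\<^sub>v q"
      unfolding mult_mat_vec_lincomb2[OF Mc wc Mxc] MMw[OF wc] by simp
    also have "\<dots> = M l *\<^sub>v w l'"
    proof -
      have "y + (1 / 2) \<cdot>\<^sub>v 0\<^sub>v q = y" if "y \<in> carrier_vec q" for y :: "real vec"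
        using that by (intro eq_vecI) auto
      then show ?thesis using Mxc .
    qed
    finally show ?thesis .
  qed
  have M_add: "M (l + l') *\<^sub>v x = M l *\<^sub>v x + M l' *\<^sub>v x"
    if "l \<in> carrier_vec 2" "l' \<in> carrier_vec 2" "x \<in> carrier_vec q" for l l' x
  proof -
    have "(r + r') \<cdot>\<^sub>v a + (t + t') \<cdot>\<^sub>v b = r \<cdot>\<^sub>v a + t \<cdot>\<^sub>v b + (r' \<cdot>\<^sub>v a + t' \<cdot>\<^sub>v b)"
      if "a \<in> carrier_vec q" "b \<in> carrier_vec q" for a b and r r' t t' :: real
      using that by (intro eq_vecI) (auto simp: algebra_simps)
    from this[OF Nc Nc] show ?thesis using that by (simp add: Mv)
  qed
  have coc: "\<alpha> (l + l') = map_mat real_of_int (U l) *\<^sub>v \<alpha> l' + \<alpha> l"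
    if l: "l \<in> carrier_vec 2" "l' \<in> carrier_vec 2" for l l'
  proof -
    have "M (l + l') *\<^sub>v (w l + w l') = M l *\<^sub>v w l + M l *\<^sub>v w l' + (M l *\<^sub>v w l' + M l' *\<^sub>v w l')"
      using M_add[OF l] wc mult_add_distrib_mat_vec[OF Mc wc wc] Mw[of l' l] by simp
    then have "\<alpha> (l + l') = w l + w l' + (1 / 2) \<cdot>\<^sub>v
        (M l *\<^sub>v w l + M l *\<^sub>v w l' + (M l *\<^sub>v w l' + M l' *\<^sub>v w l'))"
      by (simp only: \<alpha>_def w_add[OF l])
    also have "\<dots> = \<alpha> l' + M l *\<^sub>v w l' + \<alpha> l"
    proof -
      have "w l + w l' + (1 / 2) \<cdot>\<^sub>v (a + b + (b + c)) = w l' + (1 / 2) \<cdot>\<^sub>v c + b + (w l + (1 / 2) \<cdot>\<^sub>v a)"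
        if "a \<in> carrier_vec q" "b \<in> carrier_vec q" "c \<in> carrier_vec q" for a b c
        using that wc[of l] wc[of l'] by (intro eq_vecI) auto
      from this[OF Mxc Mxc Mxc] show ?thesis unfolding \<alpha>_def .
    qed
    also have "\<alpha> l' + M l *\<^sub>v w l' = map_mat real_of_int (U l) *\<^sub>v \<alpha> l'"
      by (simp add: Uv[OF l(1) \<alpha>c] M\<alpha>)
    finally show ?thesis .
  qed
  define \<phi> where "\<phi> l = affine_map q (U l) (torus_point q (\<alpha> l))" for l
  have "affine_action 2 q \<phi>"
    unfolding \<phi>_def[abs_def] by (rule affine_action_of_cocycle[OF U \<alpha>c coc])
  moreover have "free_action 2 q \<phi>"
    unfolding free_action_def
  proof (intro ballI)
    fix l x assume l: "l \<in> carrier_vec 2 - {0\<^sub>v 2 :: int vec}" and x: "x \<in> carrier (torus q)"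
    then have l2: "l \<in> carrier_vec 2" by simp
    have "l $ 0 \<noteq> 0 \<or> l $ 1 \<noteq> 0"
    proof (rule ccontr)
      assume "\<not> ?thesis"
      then have "l = 0\<^sub>v 2" using l2 by (intro eq_vecI) (auto simp: less_2_cases_iff)
      then show False using l by simp
    qed
    from gen[OF this] obtain c where c: "c \<in> carrier_vec q" "\<And>x. x \<in> carrier_vec q \<Longrightarrow> c \<bullet> (M l *\<^sub>v x) = 0"
      "\<And>m. m \<in> carrier_vec q \<Longrightarrow> c \<bullet> w l \<noteq> c \<bullet> map_vec real_of_int m"
      unfolding M_def w_def by blast
    show "\<phi> l x \<noteq> x"
      unfolding \<phi>_def
    proof (rule free_affine_map[OF UGL[OF l2] \<alpha>c c(1) _ _ x])
      show "c \<bullet> (map_mat real_of_int (U l) *\<^sub>v v) = c \<bullet> v" if "v \<in> carrier_vec q" for v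
        using c(1,2) that Mxc[of l v] by (simp add: Uv[OF l2] scalar_prod_add_distrib[of _ q])
      \<comment> \<open>\<open>c\<close> annihilates the image of \<open>M l\<close>, hence the
        correction term, so \<open>c \<bullet> \<alpha> l = c \<bullet> w l\<close>.\<close>
      show "c \<bullet> \<alpha> l \<noteq> c \<bullet> map_vec real_of_int m" if "m \<in> carrier_vec q" for m
        using c that wc[of l] Mxc[of l "w l"] by (simp add: \<alpha>_def scalar_prod_add_distrib[of _ q])
    qed
  qed
  moreover have "linear_part q (\<phi> l) = U l" if "l \<in> carrier_vec 2" for l
    unfolding \<phi>_def by (rule linear_part_affine_map[OF UGL[OF that]]) (simp add: \<alpha>c)
  ultimately show ?thesis unfolding liberated_affine_def by blast
qed

text \<open>In the coordinates given by \<open>J\<close>, the map \<open>U l - 1\<close> sends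
  \<open>(x, y)\<close> to \<open>(0, V l x)\<close>. It lands in the second factor and kills that
  factor, so any two such maps have product 0 and \<open>liberated_affine_of_square_zero\<close>
  applies.\<close>

theorem proposition4p3:
  fixes q k :: nat
    and U U1 V :: "int vec \<Rightarrow> int mat"
    and J :: "int vec \<times> int vec \<Rightarrow> int vec"
  assumes "q \<ge> 1"
    and "unipotent_action 2 q U"
    and "k = lattice_rank q (Fix 2 q U)"
    and "J \<in> iso (Zgrp (q - k) \<times>\<times> Zgrp k) (Zgrp q)"
    and "unipotent_action 2 (q - k) U1"
    and "cocycle_over 2 (q - k) k U1 V"
    and "\<And>l x y. l \<in> carrier_vec 2 \<Longrightarrow> x \<in> carrier_vec (q - k) \<Longrightarrow> y \<in> carrier_vec k \<Longrightarrow>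
           U l *\<^sub>v J (x, y) = J (U1 l *\<^sub>v x, y + V l *\<^sub>v x)"
    and "\<And>l. l \<in> carrier_vec 2 \<Longrightarrow> U1 l = 1\<^sub>m (q - k)"
  shows "liberated_affine 2 q U"
proof (rule liberated_affine_of_square_zero)
  show U: "lattice_action 2 q U" using assms(2) by (simp add: unipotent_action_def)
  show "q \<noteq> 0" using assms(1) by simp
  fix l l' :: "int vec" assume l: "l \<in> carrier_vec 2" "l' \<in> carrier_vec 2"
  note Uc = GL_carrierD(1)[OF lattice_actionD(1)[OF U]]
  have Vc: "V l \<in> carrier_mat k (q - k)" if "l \<in> carrier_vec 2" for l
    using assms(6) that by (auto simp: cocycle_over_def)
  have Jhom: "J \<in> hom (Zgrp (q - k) \<times>\<times> Zgrp k) (Zgrp q)"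
    and Jbij: "bij_betw J (carrier_vec (q - k) \<times> carrier_vec k) (carrier_vec q)"
    using assms(4) by (auto simp: iso_def monoid_vec_simps)
  have Jc: "J (x, y) \<in> carrier_vec q" if "x \<in> carrier_vec (q - k)" "y \<in> carrier_vec k" for x y
    using bij_betwE[OF Jbij] that by auto
  have J_add: "J (x, y + z) = J (x, y) + J (0\<^sub>v (q - k), z)"
    if "x \<in> carrier_vec (q - k)" "y \<in> carrier_vec k" "z \<in> carrier_vec k" for x y z
    using hom_mult[OF Jhom, of "(x, y)" "(0\<^sub>v (q - k), z)"] that by (simp add: monoid_vec_simps)
  \<comment> \<open>Triviality of \<open>U1\<close> leaves the first coordinate fixed, and
    additivity of \<open>J\<close> splits off the change in the second.\<close>
  have UJ: "U l *\<^sub>v J (x, y) = J (x, y) + J (0\<^sub>v (q - k), V l *\<^sub>v x)"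
    if "l \<in> carrier_vec 2" "x \<in> carrier_vec (q - k)" "y \<in> carrier_vec k" for l x y
    using assms(7)[OF that] assms(8)[OF that(1)] that Vc[OF that(1)] by (simp add: J_add)
  have J0: "J (0\<^sub>v (q - k), 0\<^sub>v k) = 0\<^sub>v q"
    using J_add[of "0\<^sub>v (q - k)" "0\<^sub>v k" "0\<^sub>v k"] Jc[of "0\<^sub>v (q - k)" "0\<^sub>v k"]
    by (auto simp: vec_eq_iff)
  have D: "(U l - 1\<^sub>m q) *\<^sub>v J (x, y) = J (0\<^sub>v (q - k), V l *\<^sub>v x)"
    if "l \<in> carrier_vec 2" "x \<in> carrier_vec (q - k)" "y \<in> carrier_vec k" for l x y
  proof -
    have "V l *\<^sub>v x \<in> carrier_vec k" using Vc[OF that(1)] that(2) by simp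
    then have "J (x, y) + J (0\<^sub>v (q - k), V l *\<^sub>v x) - J (x, y) = J (0\<^sub>v (q - k), V l *\<^sub>v x)"
      using Jc[OF that(2,3)] Jc[of "0\<^sub>v (q - k)" "V l *\<^sub>v x"] by (intro eq_vecI) auto
    then show ?thesis
      using UJ[OF that] Jc[OF that(2,3)] Uc[OF that(1)]
      by (simp add: minus_mult_distrib_mat_vec[of _ q q])
  qed
  have Dc: "U l - 1\<^sub>m q \<in> carrier_mat q q" for l by (simp add: minus_carrier_mat)
  have *: "((U l - 1\<^sub>m q) * (U l' - 1\<^sub>m q)) *\<^sub>v m = 0\<^sub>v q" if "m \<in> carrier_vec q" for m
  proof -
    have "m \<in> J ` (carrier_vec (q - k) \<times> carrier_vec k)"
      using that Jbij by (simp add: bij_betw_def)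
    then obtain x y where m: "m = J (x, y)"
      and xy: "x \<in> carrier_vec (q - k)" "y \<in> carrier_vec k"
      by auto
    have "V l' *\<^sub>v x \<in> carrier_vec k" using Vc[OF l(2)] xy by simp
    then have "(U l - 1\<^sub>m q) *\<^sub>v ((U l' - 1\<^sub>m q) *\<^sub>v m) = J (0\<^sub>v (q - k), V l *\<^sub>v 0\<^sub>v (q - k))"
      unfolding m D[OF l(2) xy] using D[OF l(1)] by simp
    also have "V l *\<^sub>v 0\<^sub>v (q - k) = 0\<^sub>v k" using Vc[OF l(1)] by (intro eq_vecI) auto
    finally show ?thesis
      using assoc_mult_mat_vec[OF Dc Dc that] J0 by simp
  qed
  show "(U l - 1\<^sub>m q) * (U l' - 1\<^sub>m q) = 0\<^sub>m q q"
  proof (rule eq_matI)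
    fix i j assume "i < dim_row (0\<^sub>m q q)" "j < dim_col (0\<^sub>m q q)"
    then have ij: "i < q" "j < q" by simp_all
    have P: "(U l - 1\<^sub>m q) * (U l' - 1\<^sub>m q) \<in> carrier_mat q q" by (rule mult_carrier_mat[OF Dc Dc])
    \<comment> \<open>Applying the product to the \<open>j\<close>-th unit vector reads off its
      \<open>j\<close>-th column.\<close>
    from arg_cong[OF *[of "unit_vec q j"], of "\<lambda>v. v $ i"] 
    show "((U l - 1\<^sub>m q) * (U l' - 1\<^sub>m q)) $$ (i, j) = 0\<^sub>m q q $$ (i, j)"
      using ij P by (simp add: scalar_prod_right_unit del: index_mult_mat)
  qed (use Uc l in auto)
qed

end
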